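(* Let $R$ be a unital ring with involution $*$ and let $a\in R$. The following assertions are equivalent: (i) $a$ is Moore-Penrose (MP) invertible. (ii) There exist self-adjoint idempotents $p,r\in R$ such that $pR=aR$ and $Rr=Ra$. (iii) $a$ is (von Neumann) regular and there exist self-adjoint idempotents $p,r\in R$ such that ${}^\circ a={}^\circ p$ and $a^\circ=r^\circ$. If these assertions hold, then the pair $(p,r)$ in (ii) is unique, the pair $(p,r)$ in (iii) is unique, and the two pairs coincide. Moreover, in this case the element $ra^{(1)}p$ does not depend on the choice of $a^{(1)}\in a\{1\}$, and $$a=\begin{bmatrix} a & 0 \\ 0 & 0 \end{bmatrix}_{p\times r},\qquad a^\dagger=\begin{bmatrix} ra^{(1)}p & 0 \\ 0 & 0 \end{bmatrix}_{r\times p}.$$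
   Context: For $a\in R$: $aR=\{ax:x\in R\}$, $Ra=\{xa:x\in R\}$, $a^\circ=\{x\in R: ax=0\}$, ${}^\circ a=\{x\in R: xa=0\}$. The element $a$ is regular if there is $x\in R$ with $axa=a$; $a\{1\}$ is the set of all such $x$, and $a^{(1)}$ denotes an arbitrary element of $a\{1\}$. A self-adjoint idempotent is $p$ with $p^2=p=p^*$. The element $a$ is MP invertible if there is $x\in R$ with $axa=a$, $xax=x$, $(ax)^*=ax$, $(xa)^*=xa$; such $x$ is unique and is denoted $a^\dagger$. For idempotents $s,t\in R$, the notation $x=\begin{bmatrix} x_{11} & x_{12} \\ x_{21} & x_{22} \end{bmatrix}_{s\times t}$ means $x_{11}=sxt$, $x_{12}=sx(1-t)$, $x_{21}=(1-s)xt$, $x_{22}=(1-s)x(1-t)$ (so $x$ is the sum of the four entries). *)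

theory Defs
  imports Main
begin

text \<open>
  A unital ring with involution. The base sort is \<^class>\<open>ring\<close> together with \<^class>\<open>monoid_mult\<close>
  rather than \<^class>\<open>ring_1\<close>, because the latter excludes the zero ring.
\<close>

class involution_ring = ring + monoid_mult +
  fixes star :: "'a \<Rightarrow> 'a"
  assumes star_star: "star (star x) = x"
    and star_add: "star (x + y) = star x + star y"
    and star_mult: "star (x * y) = star y * star x"

definition right_principal :: "'a::involution_ring \<Rightarrow> 'a set" where
  "right_principal a = {a * x | x. True}"

definition left_principal :: "'a::involution_ring \<Rightarrow> 'a set" where
  "left_principal a = {x * a | x. True}"

definition right_annihilator :: "'a::involution_ring \<Rightarrow> 'a set" where
  "right_annihilator a = {x. a * x = 0}"

definition left_annihilator :: "'a::involution_ring \<Rightarrow> 'a set" where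
  "left_annihilator a = {x. x * a = 0}"

text \<open>The set \<open>a{1}\<close>.\<close>

definition inner_inverses :: "'a::involution_ring \<Rightarrow> 'a set" where
  "inner_inverses a = {x. a * x * a = a}"

definition vn_regular :: "'a::involution_ring \<Rightarrow> bool" where
  "vn_regular a \<longleftrightarrow> (\<exists>x. a * x * a = a)"

definition self_adjoint_idempotent :: "'a::involution_ring \<Rightarrow> bool" where
  "self_adjoint_idempotent p \<longleftrightarrow> p * p = p \<and> star p = p"

definition is_mp_inverse :: "'a::involution_ring \<Rightarrow> 'a \<Rightarrow> bool" where
  "is_mp_inverse a x \<longleftrightarrow>
     a * x * a = a \<and> x * a * x = x \<and> star (a * x) = a * x \<and> star (x * a) = x * a"

definition mp_invertible :: "'a::involution_ring \<Rightarrow> bool" where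
  "mp_invertible a \<longleftrightarrow> (\<exists>x. is_mp_inverse a x)"

text \<open>Unspecified if \<open>a\<close> is not MP invertible.\<close>

definition mp_inverse :: "'a::involution_ring \<Rightarrow> 'a" where
  "mp_inverse a = (THE x. is_mp_inverse a x)"

text \<open>
  The matrix of \<open>x\<close> with respect to \<open>s \<times> t\<close>, as the pair of its rows; it is meant for idempotent
  \<open>s\<close> and \<open>t\<close>.
\<close>

definition block_matrix ::
    "'a::involution_ring \<Rightarrow> 'a \<Rightarrow> 'a \<Rightarrow> ('a \<times> 'a) \<times> ('a \<times> 'a)" where
  "block_matrix s t x =
     ((s * x * t,       s * x * (1 - t)),
      ((1 - s) * x * t, (1 - s) * x * (1 - t)))"

definition principal_pair :: "'a::involution_ring \<Rightarrow> 'a \<Rightarrow> 'a \<Rightarrow> bool" where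
  "principal_pair a p r \<longleftrightarrow>
     self_adjoint_idempotent p \<and> self_adjoint_idempotent r \<and>
     right_principal p = right_principal a \<and> left_principal r = left_principal a"

definition annihilator_pair :: "'a::involution_ring \<Rightarrow> 'a \<Rightarrow> 'a \<Rightarrow> bool" where
  "annihilator_pair a p r \<longleftrightarrow>
     self_adjoint_idempotent p \<and> self_adjoint_idempotent r \<and>
     left_annihilator a = left_annihilator p \<and> right_annihilator a = right_annihilator r"

end

theory Submission
  imports Defs
begin

text \<open>
  If \<open>x\<close> is an MP inverse of \<open>a\<close>, then \<open>(a * x, x * a)\<close> is a principal pair. Conversely, if
  \<open>p = a * y\<close>, \<open>r = z * a\<close> and \<open>p * a = a = a * r\<close>, then for every inner inverse \<open>x\<close> of \<open>a\<close> the element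
  \<open>w = r * x * p\<close> satisfies \<open>a * w = p\<close> and \<open>w * a = r\<close>, so it is an MP inverse. A self-adjoint
  idempotent is determined by the one-sided ideal it generates, because \<open>p * q = q\<close> and \<open>q * p = p\<close>
  become \<open>q * p = q\<close> and \<open>p * q = p\<close> after applying the involution.
\<close>

section \<open>One-sided principal ideals and annihilators\<close>

lemma right_principal_eq_imp:
  fixes a b :: "'a::involution_ring"
  assumes "right_principal a = right_principal b"
  shows "\<exists>x. a = b * x"
proof -
  have "a * 1 \<in> right_principal a"
    unfolding right_principal_def by blast
  then show ?thesis
    using assms unfolding right_principal_def by auto
qed

lemma left_principal_eq_imp:
  fixes a b :: "'a::involution_ring"
  assumes "left_principal a = left_principal b"
  shows "\<exists>x. a = x * b"
proof -
  have "1 * a \<in> left_principal a"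
    unfolding left_principal_def by blast
  then show ?thesis
    using assms unfolding left_principal_def by auto
qed

lemma right_principal_eqI:
  fixes a b :: "'a::involution_ring"
  assumes "a = b * x" and "b = a * y"
  shows "right_principal a = right_principal b"
proof -
  have "a * u = b * (x * u)" and "b * u = a * (y * u)" for u
    using assms by (metis mult.assoc)+
  then show ?thesis
    unfolding right_principal_def by auto
qed

lemma left_principal_eqI:
  fixes a b :: "'a::involution_ring"
  assumes "a = x * b" and "b = y * a"
  shows "left_principal a = left_principal b"
proof -
  have "u * a = (u * x) * b" and "u * b = (u * y) * a" for u
    using assms by (metis mult.assoc)+
  then show ?thesis
    unfolding left_principal_def by auto
qed

text \<open>Each generator is a right multiple of the other, so whatever kills one from the left
  kills the other.\<close>

lemma left_annihilator_eq_if_right_principal_eq: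
  fixes a b :: "'a::involution_ring"
  assumes "right_principal a = right_principal b"
  shows "left_annihilator a = left_annihilator b"
proof -
  obtain x y where "a = b * x" and "b = a * y"
    using assms right_principal_eq_imp by metis
  then have "u * a = 0 \<longleftrightarrow> u * b = 0" for u
    by (metis mult.assoc mult_zero_left)
  then show ?thesis
    unfolding left_annihilator_def by auto
qed

lemma right_annihilator_eq_if_left_principal_eq:
  fixes a b :: "'a::involution_ring"
  assumes "left_principal a = left_principal b"
  shows "right_annihilator a = right_annihilator b"
proof -
  obtain x y where "a = x * b" and "b = y * a"
    using assms left_principal_eq_imp by metis
  then have "a * u = 0 \<longleftrightarrow> b * u = 0" for u
    by (metis mult.assoc mult_zero_right)
  then show ?thesis
    unfolding right_annihilator_def by auto
qed

text \<open>Since \<open>e * a = a\<close> says that \<open>1 - e\<close> kills \<open>a\<close>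
  from the left, equal annihilators carry left units of \<open>a\<close> over to \<open>b\<close>.
  All later use of annihilators goes through this lemma and its mirror image.\<close>

lemma left_annihilator_eq_imp:
  fixes a b e :: "'a::involution_ring"
  assumes "left_annihilator a = left_annihilator b" and "e * a = a"
  shows "e * b = b"
proof -
  have "1 - e \<in> left_annihilator a"
    using assms(2) unfolding left_annihilator_def by (simp add: left_diff_distrib)
  then show ?thesis
    using assms(1) unfolding left_annihilator_def by (simp add: left_diff_distrib)
qed

lemma right_annihilator_eq_imp:
  fixes a b e :: "'a::involution_ring"
  assumes "right_annihilator a = right_annihilator b" and "a * e = a"
  shows "b * e = b"
proof -
  have "1 - e \<in> right_annihilator a"
    using assms(2) unfolding right_annihilator_def by (simp add: right_diff_distrib)
  then show ?thesis
    using assms(1) unfolding right_annihilator_def by (simp add: right_diff_distrib)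
qed

section \<open>Principal pairs against annihilator pairs, and uniqueness\<close>

lemma principal_imp_annihilator_pair:
  "principal_pair a p r \<Longrightarrow> annihilator_pair a p r"
  unfolding principal_pair_def annihilator_pair_def
  by (metis left_annihilator_eq_if_right_principal_eq right_annihilator_eq_if_left_principal_eq)

text \<open>An idempotent is a unit for itself on both sides, and this transfers to
  \<open>a\<close>.\<close>

lemma annihilator_pair_absorb:
  assumes "annihilator_pair a p r"
  shows "p * a = a" and "a * r = a"
  using assms unfolding annihilator_pair_def self_adjoint_idempotent_def
  by (metis left_annihilator_eq_imp, metis right_annihilator_eq_imp)

text \<open>Regularity supplies units of \<open>a\<close> that are multiples of \<open>a\<close>:
  \<open>a * x\<close> on the left and \<open>x * a\<close> on the right. Transferred to
  \<open>p\<close> and \<open>r\<close>, they put \<open>p\<close> into the right ideal and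
  \<open>r\<close> into the left ideal of \<open>a\<close>; absorption gives the reverse
  inclusions.\<close>

lemma annihilator_imp_principal_pair:
  fixes a p r :: "'a::involution_ring"
  assumes "annihilator_pair a p r" and "vn_regular a"
  shows "principal_pair a p r"
proof -
  obtain x where x: "(a * x) * a = a"
    using assms(2) unfolding vn_regular_def by blast
  have ann: "left_annihilator a = left_annihilator p" "right_annihilator a = right_annihilator r"
    using assms(1) unfolding annihilator_pair_def by auto
  have p: "p = a * (x * p)"
    using left_annihilator_eq_imp[OF ann(1) x] by (simp add: mult.assoc)
  have r: "r = (r * x) * a"
    using right_annihilator_eq_imp[OF ann(2), of "x * a"] x by (simp add: mult.assoc)
  have "right_principal p = right_principal a" "left_principal r = left_principal a"
    using right_principal_eqI[OF p] left_principal_eqI[OF r] annihilator_pair_absorb[OF assms(1)]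
    by metis+
  then show ?thesis
    using assms(1) unfolding principal_pair_def annihilator_pair_def by blast
qed

lemma annihilator_pair_unique:
  fixes a p r :: "'a::involution_ring"
  assumes "annihilator_pair a p r" and "annihilator_pair a q s"
  shows "p = q" and "r = s"
proof -
  note defs = annihilator_pair_def self_adjoint_idempotent_def
  \<comment> \<open>Both \<open>p\<close> and \<open>q\<close> have the left annihilator of
    \<open>a\<close>, so each is a left unit of the other.\<close>
  have "p * q = q" "q * p = p"
    using assms unfolding defs by (metis left_annihilator_eq_imp)+
  then show "p = q"
    using assms unfolding defs by (metis star_mult)
  have "r * s = r" "s * r = s"
    using assms unfolding defs by (metis right_annihilator_eq_imp)+
  then show "r = s"
    using assms unfolding defs by (metis star_mult)
qed

section \<open>MP inverses and principal pairs\<close>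

lemma is_mp_inverse_imp_principal_pair:
  fixes a x :: "'a::involution_ring"
  assumes "is_mp_inverse a x"
  shows "principal_pair a (a * x) (x * a)"
proof -
  have x: "a * x * a = a" "x * a * x = x" "star (a * x) = a * x" "star (x * a) = x * a"
    using assms unfolding is_mp_inverse_def by auto
  have "right_principal (a * x) = right_principal a"
    using x(1) by (intro right_principal_eqI[of _ _ x a]) simp_all
  moreover have "left_principal (x * a) = left_principal a"
    using x(1) by (intro left_principal_eqI[of _ x _ a]) (simp_all add: mult.assoc)
  moreover have "(a * x) * (a * x) = a * x" "(x * a) * (x * a) = x * a"
    using x(1,2) by (metis mult.assoc)+
  ultimately show ?thesis
    using x(3,4) unfolding principal_pair_def self_adjoint_idempotent_def by blast
qed

lemma is_mp_inverse_unique: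
  fixes a x y :: "'a::involution_ring"
  assumes "is_mp_inverse a x" and "is_mp_inverse a y"
  shows "x = y"
proof -
  have "a * x = a * y" "x * a = y * a"
    using assms by (blast intro: annihilator_pair_unique principal_imp_annihilator_pair
        is_mp_inverse_imp_principal_pair)+
  \<comment> \<open>Now \<open>x = x * a * x = x * a * y = y * a * y = y\<close>.\<close>
  then show ?thesis
    using assms unfolding is_mp_inverse_def by (metis mult.assoc)
qed

lemma mp_inverse_eqI: "is_mp_inverse a x \<Longrightarrow> mp_inverse a = x"
  unfolding mp_inverse_def by (blast intro: is_mp_inverse_unique)

lemma is_mp_inverse_principal_pair:
  fixes a p r x :: "'a::involution_ring"
  assumes pr: "principal_pair a p r" and x: "x \<in> inner_inverses a"
  shows "is_mp_inverse a (r * x * p)"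
proof -
  have pa: "p * a = a" and ar: "a * r = a"
    using annihilator_pair_absorb[OF principal_imp_annihilator_pair[OF pr]] .
  have idem: "r * r = r" and adj: "star p = p" "star r = r"
    using pr unfolding principal_pair_def self_adjoint_idempotent_def by auto
  have axa: "a * x * a = a"
    using x unfolding inner_inverses_def by simp
  obtain y z where y: "p = a * y" and z: "r = z * a"
    using pr right_principal_eq_imp left_principal_eq_imp unfolding principal_pair_def by metis
  \<comment> \<open>The factor \<open>r\<close> is absorbed by \<open>a\<close>, and
    \<open>a * x * p = a * x * a * y = a * y = p\<close>.\<close>
  have aw: "a * (r * x * p) = p"
    using ar axa y by (metis mult.assoc)
  have wa: "(r * x * p) * a = r"
    using pa axa z by (metis mult.assoc)
  \<comment> \<open>By \<open>wa\<close>, this is the outer inverse equation for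
    \<open>r * x * p\<close>.\<close>
  have "r * (r * x * p) = r * x * p"
    using idem by (metis mult.assoc)
  then show ?thesis
    unfolding is_mp_inverse_def aw wa using pa adj by simp
qed

text \<open>With \<open>p = a * y\<close> the absorption \<open>p * a = a\<close> makes
  \<open>y\<close> an inner inverse, the ingredient from which the MP inverse is built.\<close>

lemma principal_pair_imp_vn_regular:
  fixes a p r :: "'a::involution_ring"
  assumes "principal_pair a p r"
  shows "vn_regular a"
proof -
  obtain y where "p = a * y"
    using assms right_principal_eq_imp unfolding principal_pair_def by metis
  then show ?thesis
    using annihilator_pair_absorb(1)[OF principal_imp_annihilator_pair[OF assms]]
    unfolding vn_regular_def by blast
qed

lemma mp_invertible_iff_principal_pair:
  "mp_invertible a \<longleftrightarrow> (\<exists>p r. principal_pair a p r)"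
proof
  show "\<exists>p r. principal_pair a p r" if "mp_invertible a"
    using that is_mp_inverse_imp_principal_pair unfolding mp_invertible_def by blast
  show "mp_invertible a" if pair: "\<exists>p r. principal_pair a p r"
  proof -
    obtain p r where pr: "principal_pair a p r"
      using pair by blast
    then obtain x where "x \<in> inner_inverses a"
      using principal_pair_imp_vn_regular unfolding vn_regular_def inner_inverses_def by blast
    then show ?thesis
      using is_mp_inverse_principal_pair[OF pr] unfolding mp_invertible_def by blast
  qed
qed

section \<open>Corner elements and block matrices\<close>

lemma block_matrix_corner:
  fixes s t x :: "'a::involution_ring"
  assumes "s * x = x" and "x * t = x"
  shows "block_matrix s t x = ((x, 0), (0, 0))"
  \<comment> \<open>The hypotheses say \<open>(1 - s) * x = 0\<close> and
    \<open>x * (1 - t) = 0\<close>, which kills the other three entries.\<close>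
  using assms unfolding block_matrix_def
  by (simp add: left_diff_distrib right_diff_distrib)

theorem theorem2p12:
  fixes a :: "'a::involution_ring"
  shows "(mp_invertible a \<longleftrightarrow> (\<exists>p r. principal_pair a p r)) \<and>
    (mp_invertible a \<longleftrightarrow> vn_regular a \<and> (\<exists>p r. annihilator_pair a p r)) \<and>
    (mp_invertible a \<longrightarrow>
      (\<exists>!(p, r). principal_pair a p r) \<and>
      (\<exists>!(p, r). annihilator_pair a p r) \<and>
      (\<forall>p r. principal_pair a p r \<longleftrightarrow> annihilator_pair a p r) \<and>
      (\<forall>p r. principal_pair a p r \<longrightarrow>
        (\<forall>x\<in>inner_inverses a. \<forall>y\<in>inner_inverses a. r * x * p = r * y * p) \<and>
        block_matrix p r a = ((a, 0), (0, 0)) \<and>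
        (\<forall>x\<in>inner_inverses a.
          block_matrix r p (mp_inverse a) = ((r * x * p, 0), (0, 0)))))"
proof -
  have principal_iff: "principal_pair a p r \<longleftrightarrow> annihilator_pair a p r" if "vn_regular a" for p r
    using that principal_imp_annihilator_pair annihilator_imp_principal_pair by blast
  have regular_if: "vn_regular a" if "mp_invertible a"
    using that mp_invertible_iff_principal_pair principal_pair_imp_vn_regular by blast
  have mp_iff: "mp_invertible a \<longleftrightarrow> vn_regular a \<and> (\<exists>p r. annihilator_pair a p r)"
    using principal_iff regular_if mp_invertible_iff_principal_pair by blast
  have unique: "\<exists>!(p, r). annihilator_pair a p r" if inv: "mp_invertible a"
  proof -
    obtain p r where pr: "annihilator_pair a p r"
      using inv mp_iff by blast
    show ?thesis
    proof (rule ex1I[of _ "(p, r)"])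
      show "case (p, r) of (q, s) \<Rightarrow> annihilator_pair a q s"
        using pr by simp
      show "z = (p, r)" if "case z of (q, s) \<Rightarrow> annihilator_pair a q s" for z
      proof (cases z)
        case (Pair q s)
        then show ?thesis
          using that annihilator_pair_unique[of a q s p r] pr by simp
      qed
    qed
  qed
  have blocks: "(\<forall>x\<in>inner_inverses a. \<forall>y\<in>inner_inverses a. r * x * p = r * y * p) \<and>
      block_matrix p r a = ((a, 0), (0, 0)) \<and>
      (\<forall>x\<in>inner_inverses a. block_matrix r p (mp_inverse a) = ((r * x * p, 0), (0, 0)))"
    if pr: "principal_pair a p r" for p r
  proof (intro conjI ballI)
    \<comment> \<open>Both sides are MP inverses of \<open>a\<close>, hence equal.\<close>
    show "r * x * p = r * y * p" if "x \<in> inner_inverses a" "y \<in> inner_inverses a" for x y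
      using that is_mp_inverse_principal_pair[OF pr] is_mp_inverse_unique by blast
    show "block_matrix p r a = ((a, 0), (0, 0))"
      using annihilator_pair_absorb[OF principal_imp_annihilator_pair[OF pr]]
      by (rule block_matrix_corner)
    show "block_matrix r p (mp_inverse a) = ((r * x * p, 0), (0, 0))"
      if "x \<in> inner_inverses a" for x
    proof -
      \<comment> \<open>Idempotency places the MP inverse \<open>r * x * p\<close> in the corner cut
        out by \<open>r\<close> and \<open>p\<close>.\<close>
      have "p * p = p" "r * r = r"
        using pr unfolding principal_pair_def self_adjoint_idempotent_def by auto
      then have "r * (r * x * p) = r * x * p" "(r * x * p) * p = r * x * p"
        by (metis mult.assoc)+
      then show ?thesis
        unfolding mp_inverse_eqI[OF is_mp_inverse_principal_pair[OF pr that]]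
        by (rule block_matrix_corner)
    qed
  qed
  show ?thesis
  proof (intro conjI impI allI)
    show "mp_invertible a \<longleftrightarrow> (\<exists>p r. principal_pair a p r)"
      by (rule mp_invertible_iff_principal_pair)
    show "mp_invertible a \<longleftrightarrow> vn_regular a \<and> (\<exists>p r. annihilator_pair a p r)"
      by (rule mp_iff)
    assume inv: "mp_invertible a"
    show "\<exists>!(p, r). annihilator_pair a p r"
      by (rule unique[OF inv])
    \<comment> \<open>For regular \<open>a\<close> the two predicates agree, so uniqueness carries
      over by rewriting.\<close>
    then show "\<exists>!(p, r). principal_pair a p r"
      by (simp only: principal_iff[OF regular_if[OF inv]])
    show "principal_pair a p r \<longleftrightarrow> annihilator_pair a p r" for p r
      by (rule principal_iff[OF regular_if[OF inv]])
  qed (use blocks in blast)+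
qed

end
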